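(* Let $H=(h_{ij})$ be any $n\times n$ matrix with entries in $\{+1,-1\}$, let $G$ be its $n$-full oriented hypergraph, and let $\mathbf{L}_G=HH^{T}$. Then the sum $\sum_{c}(-1)^{pc(c)}$ over all contributors $c$ of $G$ lying in non-edge-monic tail-equivalence classes equals $0$, and \[ \det(\mathbf{L}_G)=\sum_{\mathcal{A}\in\mathfrak{A}_1}\ \sum_{c\in\mathcal{A}}(-1)^{pc(c)} . \]
   Context: Let $H=(h_{ij})$ be an $n\times n$ $\{\pm1\}$-matrix. Its $n$-full oriented hypergraph $G$ has vertices $v_1,\dots,v_n$, edges $e_1,\dots,e_n$, and exactly one incidence $(v_i,e_j)$ for every pair $i,j$, with orientation $\sigma(v_i,e_j)=h_{ij}$ ($H$ is the incidence matrix of $G$). A step is a triple $(v,e,w)$ of a tail vertex $v$, an edge $e$, and a head vertex $w$ (it uses tail incidence $(v,e)$ and head incidence $(w,e)$); it is a backstep if $w=v$. The sign of the step is $-\sigma(v,e)\sigma(w,e)$ (so every backstep has sign $-1$). A contributor $c$ of $G$ consists of one step $(v,f(v),\pi(v))$ for each vertex $v$, where $f:V\to E$ is an arbitrary function and $\pi:V\to V$ is a bijection; contributors correspond bijectively to pairs $(f,\pi)$. The components of $c$ are the cycles of $\pi$ (a fixed point gives a component consisting of one backstep); the sign of a component is the product of the signs of its steps, and $pc(c)$ is the number of components of $c$ of sign $+1$. Two contributors are tail-equivalent if they have the same set of tail incidences, i.e. the same $f$. A tail-equivalence class is edge-monic if $f$ is injective (so each edge contains exactly one tail incidence) and non-edge-monic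 otherwise. $\mathfrak{A}_1$ denotes the set of edge-monic tail-equivalence classes. *)

theory Defs
  imports "HOL-Analysis.Determinants" "HOL-Combinatorics.Orbits"
begin

text \<open>
  Oriented hypergraphs with at most one incidence per (vertex, edge) pair. An incidence is
  identified with that pair, and the orientation is only meaningful on the incidences.
\<close>

record ('v, 'e) oriented_hypergraph =
  verts :: "'v set"
  edges :: "'e set"
  incidences :: "('v \<times> 'e) set"
  orientation :: "'v \<Rightarrow> 'e \<Rightarrow> int"

text \<open>
  The index type \<open>'n\<close> plays the role of \<open>{1, \<dots>, n}\<close>: index \<open>i\<close> as a row of \<open>H\<close> is the vertex
  \<open>v\<^sub>i\<close>, index \<open>j\<close> as a column of \<open>H\<close> is the edge \<open>e\<^sub>j\<close>.
\<close>

definition full_hypergraph :: "int ^ 'n ^ 'n \<Rightarrow> ('n, 'n) oriented_hypergraph" where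
  "full_hypergraph H =
     \<lparr>verts = UNIV, edges = UNIV, incidences = UNIV \<times> UNIV, orientation = (\<lambda>i j. H $ i $ j)\<rparr>"

text \<open>A step is a triple (tail vertex, edge, head vertex).\<close>

type_synonym ('v, 'e) step = "'v \<times> 'e \<times> 'v"

definition is_step :: "('v, 'e) oriented_hypergraph \<Rightarrow> ('v, 'e) step \<Rightarrow> bool" where
  "is_step G = (\<lambda>(v, e, w). v \<in> verts G \<and> e \<in> edges G \<and> w \<in> verts G \<and>
     (v, e) \<in> incidences G \<and> (w, e) \<in> incidences G)"

definition step_sign :: "('v, 'e) oriented_hypergraph \<Rightarrow> ('v, 'e) step \<Rightarrow> int" where
  "step_sign G = (\<lambda>(v, e, w). - (orientation G v e * orientation G w e))"

text \<open>A contributor is represented by its set of steps.\<close>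

definition contributors :: "('v, 'e) oriented_hypergraph \<Rightarrow> ('v, 'e) step set set" where
  "contributors G =
     {(\<lambda>v. (v, f v, \<pi> v)) ` verts G | f \<pi>.
        bij_betw \<pi> (verts G) (verts G) \<and> (\<forall>v \<in> verts G. is_step G (v, f v, \<pi> v))}"

text \<open>
  The bijection \<open>\<pi>\<close> underlying a contributor. Its cycles are its orbits; the component belonging
  to a cycle is the set of steps whose tails lie on the cycle.
\<close>

definition head_map :: "('v, 'e) step set \<Rightarrow> 'v \<Rightarrow> 'v" where
  "head_map c v = (THE w. \<exists>e. (v, e, w) \<in> c)"

definition components :: "('v, 'e) step set \<Rightarrow> ('v, 'e) step set set" where
  "components c = {{s \<in> c. fst s \<in> orbit (head_map c) v} | v. v \<in> fst ` c}"

definition component_sign :: "('v, 'e) oriented_hypergraph \<Rightarrow> ('v, 'e) step set \<Rightarrow> int" where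
  "component_sign G C = (\<Prod>s \<in> C. step_sign G s)"

definition pc :: "('v, 'e) oriented_hypergraph \<Rightarrow> ('v, 'e) step set \<Rightarrow> nat" where
  "pc G c = card {C \<in> components c. component_sign G C = 1}"

definition tail_incidences :: "('v, 'e) step set \<Rightarrow> ('v \<times> 'e) set" where
  "tail_incidences c = (\<lambda>(v, e, w). (v, e)) ` c"

definition tail_equivalence ::
    "('v, 'e) oriented_hypergraph \<Rightarrow> (('v, 'e) step set \<times> ('v, 'e) step set) set" where
  "tail_equivalence G =
     {(c, d). c \<in> contributors G \<and> d \<in> contributors G \<and> tail_incidences c = tail_incidences d}"

definition tail_classes :: "('v, 'e) oriented_hypergraph \<Rightarrow> ('v, 'e) step set set set" where
  "tail_classes G = contributors G // tail_equivalence G"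

text \<open>
  The tail incidences of a contributor form the graph of the function \<open>f\<close>, so \<open>f\<close> is injective
  iff no two of them share an edge; all members of a class have the same tail incidences.
\<close>

definition edge_monic :: "('v, 'e) step set set \<Rightarrow> bool" where
  "edge_monic A \<longleftrightarrow> (\<forall>c \<in> A. inj_on snd (tail_incidences c))"

definition edge_monic_classes :: "('v, 'e) oriented_hypergraph \<Rightarrow> ('v, 'e) step set set set" where
  "edge_monic_classes G = {A \<in> tail_classes G. edge_monic A}"

definition non_edge_monic_classes ::
    "('v, 'e) oriented_hypergraph \<Rightarrow> ('v, 'e) step set set set" where
  "non_edge_monic_classes G = {A \<in> tail_classes G. \<not> edge_monic A}"

end

theory Submission
  imports Defs
begin

text \<open>
  Each component is a cycle of \<open>\<pi>\<close> and contributes the negative of its sign to \<open>(-1)^pc\<close>. A cycle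
  of length \<open>k\<close> has \<open>k\<close> step minus signs, and \<open>-(-1)^k\<close> is the sign of the cycle as a permutation;
  so \<open>(-1)^pc\<close> is \<open>sign \<pi>\<close> times the product of all \<open>\<sigma>(v, f v) \<sigma>(\<pi> v, f v)\<close>.
  For fixed \<open>f\<close>, the sum over \<open>\<pi>\<close> is therefore a multiple of the determinant of the matrix with
  columns \<open>H e\<^bsub>f v\<^esub>\<close>, which vanishes if \<open>f\<close> is not injective, while summing over all
  \<open>f\<close> and \<open>\<pi>\<close> is the multilinear expansion of the Leibniz formula for \<open>det (H H\<^sup>T)\<close>.
\<close>

section \<open>The sign of a permutation in terms of its orbits\<close>

lemma orbit_eqI_mem:
  assumes "f permutes S" "finite S" "y \<in> orbit f x"
  shows "orbit f y = orbit f x"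
  using assms by (meson cyclic_on_orbit orbit_cyclic_eq3)

lemma self_in_orbit:
  assumes "f permutes S" "finite S"
  shows "x \<in> orbit f x"
  using assms by (meson permutation_self_in_orbit permutation_permutes)

text \<open>The composed map fixes \<open>x\<close> and sends the preimage of \<open>x\<close>
  straight to \<open>f x\<close>. By injectivity no other arrow changes, so the effect is to cut
  \<open>x\<close> out of its cycle.\<close>

lemma orbit_transpose_comp:
  fixes f :: "'a \<Rightarrow> 'a"
  assumes "inj f" "f x \<noteq> x" "y \<noteq> x"
  shows "orbit (Transposition.transpose x (f x) \<circ> f) y = orbit f y - {x}"
proof -
  define g where "g = Transposition.transpose x (f x) \<circ> f"
  have g_x: "g x = x"
    by (simp add: g_def)
  have g_skip: "g w = f x" if "f w = x" for w
    using that by (simp add: g_def)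
  have g_eq: "g w = f w" if "w \<noteq> x" "f w \<noteq> x" for w
    using that assms(1) by (auto simp: g_def Transposition.transpose_def dest: injD)
  have "z \<in> orbit f y \<and> z \<noteq> x" if "z \<in> orbit g y" for z
    using that
  proof induction
    case base
    show ?case
      using assms g_skip[of y] g_eq[of y] orbit.base[of f y] orbit.step[of "f y" f y]
      by (cases "f y = x") auto
  next
    case (step z)
    then show ?case
      using assms g_skip[of z] g_eq[of z] orbit.step[of z f y] orbit.step[of "f z" f y]
      by (cases "f z = x") auto
  qed
  \<comment> \<open>The induction needs a claim at \<open>x\<close> too: when the
    \<open>f\<close>-walk passes through \<open>x\<close>, the walk of \<open>g\<close> has jumped
    over it and is already at \<open>f x\<close>.\<close>
  moreover have "(z \<noteq> x \<longrightarrow> z \<in> orbit g y) \<and> (z = x \<longrightarrow> f x \<in> orbit g y)"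
    if "z \<in> orbit f y" for z
    using that
  proof induction
    case base
    show ?case
      using assms g_skip[of y] g_eq[of y] orbit.base[of g y] by auto
  next
    case (step z)
    then show ?case
      using assms g_skip[of z] g_eq[of z] orbit.step[of z g y] by (cases "z = x") auto
  qed
  ultimately show ?thesis
    unfolding g_def[symmetric] by blast
qed

text \<open>Induction on \<open>S\<close>: a fixed point \<open>x\<close> adds only the factor
  \<open>-(-1)^1 = 1\<close>. Otherwise cutting \<open>x\<close> out of its cycle costs one
  transposition and shortens exactly one orbit by one, so both sides change sign.\<close>

lemma sign_eq_prod_orbits:
  assumes "finite S" "f permutes S"
  shows "sign f = (\<Prod>C\<in>orbit f ` S. - ((- 1) ^ card C))"
  using assms
proof (induction S arbitrary: f rule: finite_induct)
  case empty
  then show ?case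
    by simp
next
  case (insert x S)
  note perm = insert.prems
  have fin: "finite (insert x S)"
    using insert.hyps by simp
  note orb_eq = orbit_eqI_mem[OF perm fin] and orb_self = self_in_orbit[OF perm fin]
  show ?case
  proof (cases "f x = x")
    case True
    then have "f permutes S"
      using perm by (metis permutes_superset Diff_iff insertE singletonD)
    moreover have "orbit f x = {x}"
      using True by (simp add: orbit_eq_singleton_iff)
    moreover have "{x} \<notin> orbit f ` S"
      using insert.hyps orb_self by (metis imageE singletonD)
    ultimately show ?thesis
      using insert by simp
  next
    case False
    define g where "g = Transposition.transpose x (f x) \<circ> f"
    have fx: "f x \<in> insert x S"
      using permutes_in_image[OF perm, of x] by simp
    then have "g permutes insert x S"
      unfolding g_def using perm by (intro permutes_compose permutes_swap_id) auto
    moreover have "g x = x"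
      by (simp add: g_def)
    ultimately have g_perm: "g permutes S"
      by (metis permutes_superset Diff_iff insertE singletonD)
    have "f = Transposition.transpose x (f x) \<circ> g"
      by (auto simp: g_def fun_eq_iff)
    then have "sign f = sign (Transposition.transpose x (f x)) * sign g"
      using g_perm insert.hyps(1)
      by (metis sign_compose permutation_swap_id permutation_permutes)
    then have sign_f: "sign f = - sign g"
      using False by (simp add: sign_swap_id)
    have orb_g: "orbit g y = orbit f y - {x}" if "y \<in> S" for y
      unfolding g_def using that insert.hyps False permutes_inj[OF perm]
      by (intro orbit_transpose_comp) auto
    \<comment> \<open>\<open>f x\<close> represents the orbit of \<open>x\<close> inside
      \<open>S\<close>, so inserting \<open>x\<close> creates no new orbit.\<close>
    have "f x \<in> S"
      using fx False by simp
    moreover have "orbit f (f x) = orbit f x"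
      by (intro orb_eq orbit.base)
    ultimately have orbs: "orbit f ` insert x S = orbit f ` S" and x_orb: "orbit f x \<in> orbit f ` S"
      by (auto intro: rev_image_eqI)
    \<comment> \<open>Each orbit has a representative in \<open>S\<close>, hence different from
      \<open>x\<close>; it survives the removal of \<open>x\<close> and determines the
      orbit.\<close>
    have inj: "inj_on (\<lambda>C. C - {x}) (orbit f ` S)"
    proof (rule inj_onI)
      fix C D assume "C \<in> orbit f ` S" "D \<in> orbit f ` S" and eq: "C - {x} = D - {x}"
      then obtain y z where yz: "y \<in> S" "C = orbit f y" "D = orbit f z"
        by auto
      then have "y \<in> D"
        using eq orb_self[of y] insert.hyps(2) by blast
      then show "C = D"
        using yz orb_eq by simp
    qed
    have card_eq: "- ((- 1) ^ card C) =
        (if C = orbit f x then - 1 else 1) * - ((- 1) ^ card (C - {x}) :: int)"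
      if "C \<in> orbit f ` S" for C
    proof (cases "C = orbit f x")
      case True
      then have "x \<in> C" "finite C"
        using orb_self by (auto intro: finite_orbit)
      then have "card C = Suc (card (C - {x}))"
        by (metis card_Suc_Diff1)
      then show ?thesis
        using True by simp
    next
      case False
      then have "x \<notin> C"
        using that orb_eq by auto
      then show ?thesis
        using False by simp
    qed
    have "(\<Prod>C\<in>orbit f ` S. - ((- 1) ^ card C)) =
        (\<Prod>C\<in>orbit f ` S. if C = orbit f x then - 1 else 1) *
        (\<Prod>C\<in>orbit f ` S. - ((- 1) ^ card (C - {x}) :: int))"
      by (simp only: prod.distrib[symmetric] card_eq cong: prod.cong)
    also have "(\<Prod>C\<in>orbit f ` S. if C = orbit f x then - 1 else (1 :: int)) = - 1"
      using insert.hyps(1) x_orb by (subst prod.delta) auto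
    also have "(\<Prod>C\<in>orbit f ` S. - ((- 1) ^ card (C - {x}) :: int)) =
        (\<Prod>C\<in>(\<lambda>C. C - {x}) ` orbit f ` S. - ((- 1) ^ card C))"
      by (simp add: prod.reindex[OF inj])
    also have "(\<lambda>C. C - {x}) ` orbit f ` S = orbit g ` S"
      using orb_g by (auto simp: image_image)
    also have "(\<Prod>C\<in>orbit g ` S. - ((- 1) ^ card C)) = sign g"
      using insert.IH[OF g_perm] by simp
    finally show ?thesis
      using sign_f orbs by simp
  qed
qed

lemma prod_over_orbits:
  assumes "finite S" "f permutes S"
  shows "(\<Prod>C\<in>orbit f ` S. prod h C) = prod h S"
proof -
  have "\<Union> (orbit f ` S) = S"
    using permutes_orbit_subset[OF assms(2)] self_in_orbit[OF assms(2,1)] by auto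
  moreover have "prod h (\<Union> (orbit f ` S)) = (\<Prod>C\<in>orbit f ` S. prod h C)"
  proof (subst prod.Union_disjoint)
    show "\<forall>C\<in>orbit f ` S. finite C"
      using self_in_orbit[OF assms(2,1)] by (auto intro: finite_orbit)
    show "\<forall>C\<in>orbit f ` S. \<forall>D\<in>orbit f ` S. C \<noteq> D \<longrightarrow> C \<inter> D = {}"
      using orbit_eqI_mem[OF assms(2,1)] by blast
  qed simp
  ultimately show ?thesis
    by simp
qed

section \<open>Contributors of the full hypergraph\<close>

definition contributor :: "('v \<Rightarrow> 'e) \<Rightarrow> ('v \<Rightarrow> 'v) \<Rightarrow> ('v, 'e) step set" where
  "contributor f \<pi> = range (\<lambda>v. (v, f v, \<pi> v))"

lemma contributor_eq_iff [simp]: "contributor f \<pi> = contributor g \<rho> \<longleftrightarrow> f = g \<and> \<pi> = \<rho>"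
proof
  assume eq: "contributor f \<pi> = contributor g \<rho>"
  have "(v, f v, \<pi> v) \<in> contributor g \<rho>" for v
    unfolding eq[symmetric] by (simp add: contributor_def)
  then show "f = g \<and> \<pi> = \<rho>"
    by (auto simp: contributor_def)
qed simp

lemma tail_incidences_contributor: "tail_incidences (contributor f \<pi>) = range (\<lambda>v. (v, f v))"
  by (simp add: tail_incidences_def contributor_def image_image)

lemma head_map_contributor: "head_map (contributor f \<pi>) = \<pi>"
  by (auto simp: head_map_def contributor_def fun_eq_iff)

lemma components_contributor:
  "components (contributor f \<pi>) = (\<lambda>C. (\<lambda>v. (v, f v, \<pi> v)) ` C) ` range (orbit \<pi>)"
proof -
  have "{s \<in> contributor f \<pi>. fst s \<in> C} = (\<lambda>v. (v, f v, \<pi> v)) ` C" for C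
    by (auto simp: contributor_def)
  moreover have "fst ` contributor f \<pi> = UNIV"
    by (auto simp: contributor_def image_image)
  ultimately show ?thesis
    by (auto simp: components_def head_map_contributor)
qed

lemma contributors_full:
  fixes H :: "int ^ 'n ^ 'n"
  shows "contributors (full_hypergraph H) = {contributor f \<pi> | f \<pi>. \<pi> permutes UNIV}"
  by (auto simp: contributors_def full_hypergraph_def is_step_def contributor_def
      intro: bij_imp_permutes permutes_bij)

section \<open>The weight of a single contributor\<close>

lemma prod_signs:
  fixes s :: "'a \<Rightarrow> int"
  assumes "\<And>x. x \<in> A \<Longrightarrow> s x \<in> {1, - 1}"
  shows "prod s A \<in> {1, - 1}"
  using assms
proof (induction A rule: infinite_finite_induct)
  case (insert x A)
  then have "s x \<in> {1, - 1}" "prod s A \<in> {1, - 1}"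
    by blast+
  with insert.hyps show ?case
    by auto
qed auto

lemma neg_one_power_card:
  fixes s :: "'a \<Rightarrow> int"
  assumes "finite A" "\<And>x. x \<in> A \<Longrightarrow> s x \<in> {1, - 1}"
  shows "(- 1) ^ card {x \<in> A. s x = 1} = (\<Prod>x\<in>A. - s x)"
proof -
  have "(\<Prod>x\<in>A. - s x) = (\<Prod>x\<in>A. if s x = 1 then - 1 else 1)"
    using assms(2) by (intro prod.cong) auto
  also have "\<dots> = (- 1) ^ card {x \<in> A. s x = 1}"
    using assms(1) by (simp add: prod.If_cases Int_def)
  finally show ?thesis
    by simp
qed

lemma neg_one_power_pc:
  fixes H :: "int ^ 'n ^ 'n"
  assumes H: "\<And>i j. H $ i $ j \<in> {1, -1}" and perm: "\<pi> permutes UNIV"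
  shows "(- 1) ^ pc (full_hypergraph H) (contributor f \<pi>) =
    sign \<pi> * (\<Prod>v\<in>UNIV. H $ v $ f v * H $ \<pi> v $ f v)"
proof -
  let ?G = "full_hypergraph H" and ?st = "\<lambda>v. (v, f v, \<pi> v)"
  let ?h = "\<lambda>v. H $ v $ f v * H $ \<pi> v $ f v"
  \<comment> \<open>Distinct orbits give distinct components, so products over components can be
    reindexed by orbits.\<close>
  have inj: "inj_on ((`) ?st) A" for A
    by (rule inj_on_image) (auto simp: inj_on_def)
  have sign: "component_sign ?G (?st ` C) = (- 1) ^ card C * prod ?h C" for C
  proof -
    have "component_sign ?G (?st ` C) = (\<Prod>v\<in>C. - ?h v)"
      unfolding component_sign_def
      by (subst prod.reindex) (auto simp: inj_on_def step_sign_def full_hypergraph_def)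
    then show ?thesis
      by (simp add: prod_uminus)
  qed
  have "component_sign ?G C \<in> {1, - 1}" for C
    unfolding component_sign_def
  proof (rule prod_signs)
    fix s :: "('n, 'n) step"
    obtain v e w where "s = (v, e, w)"
      by (cases s)
    then show "step_sign ?G s \<in> {1, - 1}"
      using H[of v e] H[of w e] by (auto simp: step_sign_def full_hypergraph_def)
  qed
  then have "(- 1) ^ pc ?G (contributor f \<pi>) =
      (\<Prod>C\<in>components (contributor f \<pi>). - component_sign ?G C)"
    unfolding pc_def by (intro neg_one_power_card) (auto simp: components_contributor)
  also have "\<dots> = (\<Prod>C\<in>range (orbit \<pi>). - ((- 1) ^ card C) * prod ?h C)"
    by (simp add: components_contributor prod.reindex[OF inj] sign)
  also have "\<dots> = sign \<pi> * prod ?h UNIV"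
    using perm by (simp only: prod.distrib sign_eq_prod_orbits[OF finite perm]
        prod_over_orbits[OF finite perm])
  finally show ?thesis .
qed

section \<open>Tail-equivalence classes\<close>

text \<open>Classes are parametrised by \<open>f\<close>, the data shared by all members, with only
  the permutation of heads varying.\<close>

definition tail_class :: "('v \<Rightarrow> 'e) \<Rightarrow> ('v, 'e) step set set" where
  "tail_class f = contributor f ` {\<pi>. \<pi> permutes UNIV}"

lemma inj_tail_class: "inj tail_class"
proof (rule injI)
  fix f g :: "'v \<Rightarrow> 'e" assume "tail_class f = tail_class g"
  then have "contributor f id \<in> tail_class g"
    unfolding tail_class_def by (metis image_eqI mem_Collect_eq permutes_id)
  then show "f = g"
    by (auto simp: tail_class_def)
qed

lemma tail_classes_full:
  fixes H :: "int ^ 'n ^ 'n"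
  shows "tail_classes (full_hypergraph H) = range tail_class"
proof -
  have graph: "range (\<lambda>v. (v, f v)) = range (\<lambda>v. (v, g v)) \<longleftrightarrow> f = g" for f g :: "'n \<Rightarrow> 'n"
    by (auto simp: fun_eq_iff set_eq_iff)
  have "tail_equivalence (full_hypergraph H) `` {contributor f \<pi>} = tail_class f"
    if "\<pi> permutes UNIV" for f \<pi>
    using that
    by (auto simp: tail_equivalence_def contributors_full tail_incidences_contributor graph
        tail_class_def)
  then show ?thesis
    unfolding tail_classes_def quotient_def contributors_full
    by (auto intro: permutes_id)
qed

text \<open>All members share the tail incidences given by \<open>f\<close>. The contributor of the
  identity makes the class nonempty, so the quantifier in \<open>edge_monic\<close> is not
  vacuous.\<close>

lemma edge_monic_tail_class: "edge_monic (tail_class f) \<longleftrightarrow> inj f"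
proof -
  have "inj_on snd (range (\<lambda>v. (v, f v))) \<longleftrightarrow> inj f"
    by (auto simp: inj_on_def)
  then show ?thesis
    by (auto simp: edge_monic_def tail_class_def tail_incidences_contributor intro: permutes_id)
qed

section \<open>Class sums as determinants\<close>

lemma sum_tail_class:
  fixes H :: "int ^ 'n ^ 'n"
  assumes "\<And>i j. H $ i $ j \<in> {1, -1}"
  shows "(\<Sum>c\<in>tail_class f. (- 1) ^ pc (full_hypergraph H) c) =
    (\<Sum>\<pi> | \<pi> permutes UNIV. sign \<pi> * (\<Prod>v\<in>UNIV. H $ v $ f v * H $ \<pi> v $ f v))"
  unfolding tail_class_def
  by (subst sum.reindex) (auto simp: inj_on_def neg_one_power_pc[OF assms])

text \<open>The tail signs do not depend on \<open>\<pi>\<close> and factor out; the head signs form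
  the Leibniz expansion of the matrix whose row \<open>v\<close> is column \<open>f v\<close> of
  \<open>H\<close>.\<close>

lemma sum_tail_class_eq_det:
  fixes H :: "int ^ 'n ^ 'n"
  assumes "\<And>i j. H $ i $ j \<in> {1, -1}"
  shows "(\<Sum>c\<in>tail_class f. (- 1) ^ pc (full_hypergraph H) c) =
    (\<Prod>v\<in>UNIV. H $ v $ f v) * det (\<chi> v w. H $ w $ f v)"
  by (simp add: sum_tail_class[OF assms] det_def prod.distrib sum_distrib_left mult_ac)

lemma sum_tail_class_not_inj:
  fixes H :: "int ^ 'n ^ 'n"
  assumes "\<And>i j. H $ i $ j \<in> {1, -1}" "\<not> inj f"
  shows "(\<Sum>c\<in>tail_class f. (- 1) ^ pc (full_hypergraph H) c) = (0 :: int)"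
proof -
  obtain v w where "v \<noteq> w" "f v = f w"
    using assms(2) by (auto simp: inj_def)
  then have "det (\<chi> v w. H $ w $ f v) = 0"
    by (intro det_identical_rows[of v w]) (auto simp: row_def vec_eq_iff)
  then show ?thesis
    by (simp add: sum_tail_class_eq_det[OF assms(1)])
qed

lemma det_eq_sum_tail_classes:
  fixes H :: "int ^ 'n ^ 'n"
  assumes "\<And>i j. H $ i $ j \<in> {1, -1}"
  shows "det (H ** transpose H) =
    (\<Sum>f\<in>UNIV. \<Sum>c\<in>tail_class f. (- 1) ^ pc (full_hypergraph H) c)"
proof -
  have "det (H ** transpose H) =
      (\<Sum>\<pi> | \<pi> permutes UNIV. sign \<pi> * (\<Prod>v\<in>UNIV. \<Sum>e\<in>UNIV. H $ v $ e * H $ \<pi> v $ e))"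
    by (simp add: det_def matrix_matrix_mult_def transpose_def)
  also have "\<dots> = (\<Sum>\<pi> | \<pi> permutes UNIV. \<Sum>f\<in>UNIV.
      sign \<pi> * (\<Prod>v\<in>UNIV. H $ v $ f v * H $ \<pi> v $ f v))"
    \<comment> \<open>Distributing the product over the sums picks one edge for each vertex, which
      is an arbitrary function \<open>f\<close>.\<close>
    by (simp add: prod_sum_PiE sum_distrib_left PiE_UNIV_domain)
  also have "\<dots> = (\<Sum>f\<in>UNIV. \<Sum>c\<in>tail_class f. (- 1) ^ pc (full_hypergraph H) c)"
    by (subst sum.swap) (simp add: sum_tail_class[OF assms])
  finally show ?thesis .
qed

theorem theorem2:
  fixes H :: "int ^ 'n ^ 'n"
  assumes "\<And>i j. H $ i $ j \<in> {1, -1}"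
  shows "(\<Sum>c \<in> \<Union> (non_edge_monic_classes (full_hypergraph H)). (-1) ^ pc (full_hypergraph H) c)
           = (0 :: int) \<and>
         det (H ** transpose H)
           = (\<Sum>A \<in> edge_monic_classes (full_hypergraph H). \<Sum>c \<in> A. (-1) ^ pc (full_hypergraph H) c)"
proof
  let ?w = "\<lambda>c. (-1) ^ pc (full_hypergraph H) c :: int"
  have non_monic: "non_edge_monic_classes (full_hypergraph H) = tail_class ` {f. \<not> inj f}"
    by (auto simp: non_edge_monic_classes_def tail_classes_full edge_monic_tail_class)
  have monic: "edge_monic_classes (full_hypergraph H) = tail_class ` {f. inj f}"
    by (auto simp: edge_monic_classes_def tail_classes_full edge_monic_tail_class)
  have "sum ?w (\<Union> (tail_class ` {f. \<not> inj f})) = (\<Sum>f | \<not> inj f. sum ?w (tail_class f))"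
    \<comment> \<open>Classes of different \<open>f\<close> are disjoint because a contributor
      determines its \<open>f\<close>.\<close>
    by (rule sum.UNION_disjoint) (auto simp: tail_class_def)
  then show "sum ?w (\<Union> (non_edge_monic_classes (full_hypergraph H))) = 0"
    by (simp add: non_monic sum_tail_class_not_inj[OF assms])
  have "det (H ** transpose H) = (\<Sum>f | inj f. sum ?w (tail_class f))"
    unfolding det_eq_sum_tail_classes[OF assms]
    \<comment> \<open>Non-injective \<open>f\<close> have class sum zero, so only the injective ones
      remain.\<close>
    by (rule sum.mono_neutral_right) (auto simp: sum_tail_class_not_inj[OF assms])
  then show "det (H ** transpose H) = (\<Sum>A \<in> edge_monic_classes (full_hypergraph H). sum ?w A)"
    by (simp add: monic sum.reindex[OF inj_on_subset[OF inj_tail_class subset_UNIV]])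
qed

end
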